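(* Let $g$ be a nonnegative integer and $s$ a positive integer. For each positive integer $m$, $$\sum_{n\ge 0}K_g^{(s)}(n,m)\,q^n\, P_{g,\le n+m}^{(s)}(-1,q)=1$$ as formal power series in $q$.
   Context: A partition $\lambda=(\lambda_1,\ldots,\lambda_{\ell(\lambda)})$ is a nondecreasing finite sequence of positive integers $\lambda_1\le\cdots\le\lambda_{\ell(\lambda)}$; $|\lambda|$ is the sum of its parts and $\ell(\lambda)$ its number of parts. A composition $\kappa=(\kappa_1,\ldots,\kappa_{\ell(\kappa)})$ of $n$ is a finite sequence of positive integers (in any order) with sum $|\kappa|=n$; $\ell(\kappa)$ is its number of parts. The empty sequence is allowed as a partition and as a composition (of $0$). For a nonnegative integer $g$ and a positive integer $s$: $\mathscr{C}_g^{(s)}$ is the set of compositions $\kappa$ with all parts at least $s$ and $\kappa_{i+1}-\kappa_i\ge -(g-1)$ for all $1\le i\le\ell(\kappa)-1$. For a nonnegative integer $N$, $\mathscr{P}_{g,\le N}^{(s)}$ is the set of partitions $\lambda$ with all parts at least $s$, with $\lambda_{i+1}-\lambda_i\ge g$ for all $1\le i\le\ell(\lambda)-1$, and with largest part $\lambda_{\ell(\lambda)}\le N$. Both sets contain the empty sequence. Put $$P_{g,\le N}^{(s)}(x,q):=\sum_{\lambda\in\mathscr{P}_{g,\le N}^{(s)}}x^{\ell(\lambda)}q^{|\lambda|}.$$ For a nonnegative integer $m$, a composition $\kappa$ is called $m$-step if $\kappa_j\le m+\sum_{i=0}^{j-1}\kappa_i$ for each part $\kappa_j$ ($1\le j\le\ell(\kappa)$),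 with the convention $\kappa_0=0$; the empty composition is $m$-step. $K_g^{(s)}(n,m)$ denotes the number of $m$-step compositions of $n$ in $\mathscr{C}_g^{(s)}$. *)

theory Defs
  imports "HOL-Computational_Algebra.Formal_Power_Series"
begin

text \<open>
  Compositions and partitions are lists of positive naturals, indexed from 0, so that
  \<open>xs ! i\<close> is the part with index \<open>i + 1\<close>. The empty list is allowed.
\<close>

definition composition :: "nat list \<Rightarrow> bool" where
  "composition xs \<longleftrightarrow> (\<forall>k\<in>set xs. 0 < k)"

text \<open>Partitions are written in nondecreasing order.\<close>

definition partition :: "nat list \<Rightarrow> bool" where
  "partition xs \<longleftrightarrow> (\<forall>k\<in>set xs. 0 < k) \<and> sorted xs"

text \<open>
  The differences are taken in the integers; for \<open>g = 0\<close> the bound \<open>- (g - 1)\<close> is 1.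
\<close>

definition gap_compositions :: "nat \<Rightarrow> nat \<Rightarrow> nat list set" where
  "gap_compositions g s =
    {xs. composition xs \<and> (\<forall>k\<in>set xs. s \<le> k) \<and>
         (\<forall>i. Suc i < length xs \<longrightarrow> int (xs ! Suc i) - int (xs ! i) \<ge> - (int g - 1))}"

definition gap_partitions :: "nat \<Rightarrow> nat \<Rightarrow> nat \<Rightarrow> nat list set" where
  "gap_partitions g s N =
    {xs. partition xs \<and> (\<forall>k\<in>set xs. s \<le> k) \<and>
         (\<forall>i. Suc i < length xs \<longrightarrow> int (xs ! Suc i) - int (xs ! i) \<ge> int g) \<and>
         (xs \<noteq> [] \<longrightarrow> last xs \<le> N)}"

definition step_composition :: "nat \<Rightarrow> nat list \<Rightarrow> bool" where
  "step_composition m xs \<longleftrightarrow> (\<forall>j<length xs. xs ! j \<le> m + (\<Sum>i<j. xs ! i))"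

definition K :: "nat \<Rightarrow> nat \<Rightarrow> nat \<Rightarrow> nat \<Rightarrow> nat" where
  "K g s n m = card {xs \<in> gap_compositions g s. sum_list xs = n \<and> step_composition m xs}"

text \<open>
  The generating function of \<open>gap_partitions g s N\<close> as a power series in \<open>q\<close>, with \<open>x\<close>
  specialised to a ring element. For \<open>g = 0\<close> the set of partitions may be infinite, so the
  series is given by its coefficients, each of which is a finite sum
  (\<open>finite_gap_partitions\<close> below).
\<close>

definition P :: "nat \<Rightarrow> nat \<Rightarrow> nat \<Rightarrow> 'a::comm_ring_1 \<Rightarrow> 'a fps" where
  "P g s N x = Abs_fps (\<lambda>n. \<Sum>xs\<in>{xs \<in> gap_partitions g s N. sum_list xs = n}. x ^ length xs)"

lemma finite_compositions: "finite {xs. composition xs \<and> sum_list xs = n}"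
proof (rule finite_subset)
  have "length xs \<le> sum_list xs" if "composition xs" for xs
    using that by (induction xs) (auto simp: composition_def)
  then show "{xs. composition xs \<and> sum_list xs = n} \<subseteq> {xs. set xs \<subseteq> {..n} \<and> length xs \<le> n}"
    using member_le_sum_list by fastforce
qed (rule finite_lists_length_le, simp)

lemma finite_gap_partitions: "finite {xs \<in> gap_partitions g s N. sum_list xs = n}"
  by (rule finite_subset[OF _ finite_compositions[of n]])
     (auto simp: gap_partitions_def partition_def composition_def)

lemma finite_gap_compositions:
  "finite {xs \<in> gap_compositions g s. sum_list xs = n \<and> step_composition m xs}"
  by (rule finite_subset[OF _ finite_compositions[of n]]) (auto simp: gap_compositions_def)

end

theory Submission imports Defs begin

text \<open>
  The coefficient of \<open>q\<^sup>M\<close> on the left is the sum of \<open>(- 1) ^ length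
  ys\<close> over the pairs of a composition \<open>xs\<close> and a partition
  \<open>ys\<close> of total size \<open>M\<close>, where \<open>xs\<close> is
  \<open>m\<close>-step and the largest part of \<open>ys\<close> is at most \<open>m +
  sum_list xs\<close>. Read such a pair as the word \<open>xs @ rev ys\<close> cut at one
  place. In the composition a part \<open>a\<close> may be followed by \<open>b\<close> exactly
  if \<open>a < b + g\<close>; in the reversed partition, exactly if \<open>b + g \<le>
  a\<close>. The two conditions are complementary, so if neither list is empty, exactly one of
  them holds at the cut, and the cut can be shifted by one letter in exactly one direction; if
  one list is empty, only one direction is possible, and nothing obstructs it. That is, either
  the largest part of \<open>ys\<close> becomes the last part of \<open>xs\<close>, or the
  reverse. The bound on the largest part of \<open>ys\<close> is precisely the step condition
  on a part appended to \<open>xs\<close>, so the shift stays within the admissible pairs. It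
  is undone by the opposite shift and flips the sign, and only the pair of empty lists admits
  no shift (\<open>sum_signed_pairs\<close>). That pair accounts for the constant term 1.
\<close>

lemma gap_compositions_Nil: "[] \<in> gap_compositions g s"
  by (simp add: gap_compositions_def composition_def)

lemma gap_partitions_Nil: "[] \<in> gap_partitions g s N"
  by (simp add: gap_partitions_def partition_def)

lemma step_composition_Nil: "step_composition m []"
  by (simp add: step_composition_def)

lemma adjacent_snoc_iff:
  "(\<forall>i. Suc i < length (xs @ [a]) \<longrightarrow> R ((xs @ [a]) ! i) ((xs @ [a]) ! Suc i)) \<longleftrightarrow>
   (\<forall>i. Suc i < length xs \<longrightarrow> R (xs ! i) (xs ! Suc i)) \<and> (xs \<noteq> [] \<longrightarrow> R (last xs) a)"
proof (cases xs rule: rev_cases)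
  case (snoc ys b)
  then show ?thesis
    by (auto simp: nth_append less_Suc_eq all_conj_distrib)
qed simp

lemma gap_compositions_snoc_iff:
  "xs @ [a] \<in> gap_compositions g s \<longleftrightarrow>
   xs \<in> gap_compositions g s \<and> 0 < a \<and> s \<le> a \<and> (xs \<noteq> [] \<longrightarrow> last xs < a + g)"
  using adjacent_snoc_iff[of xs a "\<lambda>x y. int y - int x \<ge> - (int g - 1)"]
  unfolding gap_compositions_def composition_def by auto

text \<open>
  Since \<open>g\<close> is nonnegative, the gap before \<open>a\<close> already gives \<open>last ys \<le> a\<close>. This keeps the
  longer list sorted and makes \<open>a\<close> the bound on the parts of \<open>ys\<close> in place of \<open>N\<close>.
\<close>

lemma gap_partitions_snoc_iff:
  "ys @ [a] \<in> gap_partitions g s N \<longleftrightarrow>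
   ys \<in> gap_partitions g s a \<and> 0 < a \<and> s \<le> a \<and> a \<le> N \<and> (ys \<noteq> [] \<longrightarrow> last ys + g \<le> a)"
proof -
  have "sorted (ys @ [a]) \<longleftrightarrow> sorted ys \<and> (ys \<noteq> [] \<longrightarrow> last ys \<le> a)"
    by (cases ys rule: rev_cases) (auto simp: sorted_append)
  then show ?thesis
    using adjacent_snoc_iff[of ys a "\<lambda>x y. int y - int x \<ge> int g"]
    unfolding gap_partitions_def partition_def by auto
qed

lemma step_composition_snoc_iff:
  "step_composition m (xs @ [a]) \<longleftrightarrow> step_composition m xs \<and> a \<le> m + sum_list xs"
proof -
  have "(\<Sum>i<j. (xs @ [a]) ! i) = (\<Sum>i<j. xs ! i)" if "j \<le> length xs" for j
    using that by (intro sum.cong) (auto simp: nth_append)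
  then show ?thesis
    by (auto simp: step_composition_def less_Suc_eq nth_append sum_list_sum_nth
                   atLeast0LessThan)
qed

definition step_gap_compositions :: "nat \<Rightarrow> nat \<Rightarrow> nat \<Rightarrow> nat list set" where
  "step_gap_compositions g s m = {xs \<in> gap_compositions g s. step_composition m xs}"

definition cut_pairs :: "nat \<Rightarrow> nat \<Rightarrow> nat \<Rightarrow> nat \<Rightarrow> (nat list \<times> nat list) set" where
  "cut_pairs g s m M =
    (SIGMA xs:{xs \<in> step_gap_compositions g s m. sum_list xs \<le> M}.
       {ys \<in> gap_partitions g s (sum_list xs + m). sum_list ys = M - sum_list xs})"

lemma finite_step_gap_compositions:
  "finite {xs \<in> step_gap_compositions g s m. sum_list xs \<le> M}"
proof (rule finite_subset)
  show "{xs \<in> step_gap_compositions g s m. sum_list xs \<le> M} \<subseteq>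
      (\<Union>n\<le>M. {xs. composition xs \<and> sum_list xs = n})"
    by (auto simp: step_gap_compositions_def gap_compositions_def)
qed (simp add: finite_compositions)

lemma finite_cut_pairs: "finite (cut_pairs g s m M)"
  unfolding cut_pairs_def
  by (intro finite_SigmaI finite_step_gap_compositions finite_gap_partitions)

text \<open>
  Both sides describe the word \<open>xs @ [a] @ rev ys\<close>. On the left the cut is before \<open>a\<close>, and the
  extra condition lets \<open>a\<close> extend the composition; on the right the cut is after \<open>a\<close>, and the
  extra condition lets \<open>a\<close> extend the partition. Each extra condition is part of membership on
  the other side, and \<open>a \<le> m + sum_list xs\<close> is the size bound on the left and the step
  condition on the right.
\<close>

lemma cut_pairs_shift_iff:
  "(xs, ys @ [a]) \<in> cut_pairs g s m M \<and> (xs \<noteq> [] \<longrightarrow> last xs < a + g) \<longleftrightarrow>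
   (xs @ [a], ys) \<in> cut_pairs g s m M \<and> (ys \<noteq> [] \<longrightarrow> last ys + g \<le> a)"
proof -
  let ?N = "sum_list xs + m"
  have "ys \<in> gap_partitions g s a \<longleftrightarrow> ys \<in> gap_partitions g s (?N + a)"
    if "ys \<noteq> [] \<longrightarrow> last ys + g \<le> a"
    using that by (auto simp: gap_partitions_def)
  moreover have "sum_list (ys @ [a]) = M - sum_list xs \<and> sum_list xs \<le> M \<longleftrightarrow>
      sum_list ys = M - sum_list (xs @ [a]) \<and> sum_list (xs @ [a]) \<le> M"
    by auto
  moreover have "sum_list (xs @ [a]) + m = ?N + a" "m + sum_list xs = ?N"
    by simp_all
  ultimately show ?thesis
    unfolding cut_pairs_def step_gap_compositions_def mem_Sigma_iff mem_Collect_eq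
      gap_compositions_snoc_iff gap_partitions_snoc_iff step_composition_snoc_iff
    by metis
qed

lemma sum_signed_pairs:
  "(\<Sum>(xs, ys)\<in>cut_pairs g s m M. (- 1) ^ length ys) = (if M = 0 then 1 else 0 :: int)"
proof -
  let ?w = "\<lambda>(xs :: nat list, ys :: nat list). (- 1) ^ length ys :: int"
  define A where "A = {(xs, ys) \<in> cut_pairs g s m M.
     ys \<noteq> [] \<and> (xs \<noteq> [] \<longrightarrow> last xs < last ys + g)}"
  define B where "B = {(xs, ys) \<in> cut_pairs g s m M.
     xs \<noteq> [] \<and> (ys \<noteq> [] \<longrightarrow> last ys + g \<le> last xs)}"
  define E where "E = {p \<in> cut_pairs g s m M. p = ([], [])}"
  have split: "cut_pairs g s m M = E \<union> (A \<union> B)"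
    by (auto simp: A_def B_def E_def)
  have disjoint: "E \<inter> (A \<union> B) = {}" "A \<inter> B = {}"
    by (auto simp: A_def B_def E_def)
  have fin: "finite E" "finite A" "finite B"
    using finite_cut_pairs[of g s m M] split by (metis finite_Un)+
  have "sum ?w A = (\<Sum>p\<in>B. - ?w p)"
  proof (rule sum.reindex_bij_witness
      [where j = "\<lambda>(xs, ys). (xs @ [last ys], butlast ys)"
         and i = "\<lambda>(xs, ys). (butlast xs, ys @ [last xs])"])
    show "(case p of (xs, ys) \<Rightarrow> (xs @ [last ys], butlast ys)) \<in> B" if "p \<in> A" for p
    proof -
      obtain xs ys where p: "p = (xs, ys)" by (cases p)
      with that obtain zs a where "ys = zs @ [a]"
        by (cases ys rule: rev_cases) (auto simp: A_def)
      with p that show ?thesis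
        using cut_pairs_shift_iff[of xs zs a g s m M] by (simp add: A_def B_def)
    qed
    show "(case p of (xs, ys) \<Rightarrow> (butlast xs, ys @ [last xs])) \<in> A" if "p \<in> B" for p
    proof -
      obtain xs ys where p: "p = (xs, ys)" by (cases p)
      with that obtain zs a where "xs = zs @ [a]"
        by (cases xs rule: rev_cases) (auto simp: B_def)
      with p that show ?thesis
        using cut_pairs_shift_iff[of zs ys a g s m M] by (simp add: A_def B_def)
    qed
    show "- ?w (case p of (xs, ys) \<Rightarrow> (xs @ [last ys], butlast ys)) = ?w p" if "p \<in> A" for p
    proof -
      obtain xs ys where p: "p = (xs, ys)" by (cases p)
      with that obtain zs a where "ys = zs @ [a]"
        by (cases ys rule: rev_cases) (auto simp: A_def)
      with p show ?thesis by simp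
    qed
  qed (auto simp: A_def B_def)
  then have "sum ?w (cut_pairs g s m M) = sum ?w E"
    unfolding split using fin disjoint by (simp add: sum.union_disjoint sum_negf)
  moreover have "E = (if M = 0 then {([], [])} else {})"
    by (auto simp: E_def cut_pairs_def step_gap_compositions_def gap_compositions_Nil
          gap_partitions_Nil step_composition_Nil)
  ultimately show ?thesis by simp
qed

unbundle fps_syntax

lemma fps_sums_eventually_nth:
  fixes f :: "nat \<Rightarrow> 'a::comm_ring_1 fps"
  assumes "\<And>M N. M < N \<Longrightarrow> (\<Sum>n<N. f n $ M) = F $ M"
  shows "f sums F"
  unfolding sums_def
proof (rule tendsto_fpsI)
  show "\<forall>\<^sub>F N in sequentially. (\<Sum>n<N. f n) $ M = F $ M" for M
    using eventually_gt_at_top[of M] by eventually_elim (simp add: fps_sum_nth assms)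
qed

text \<open>
  The factor \<open>q\<^sup>n\<close> confines the term of index \<open>n\<close> to degrees at least \<open>n\<close>, so only
  compositions of size at most \<open>M\<close> contribute to \<open>q\<^sup>M\<close>.
\<close>

lemma nth_partial_sum:
  assumes "M < N"
  shows "(\<Sum>n<N. (of_nat (K g s n m) * fps_X ^ n * P g s (n + m) (- 1) :: int fps) $ M) =
    (\<Sum>(xs, ys)\<in>cut_pairs g s m M. (- 1) ^ length ys)"
proof -
  let ?C = "{xs \<in> step_gap_compositions g s m. sum_list xs \<le> M}"
  let ?p = "\<lambda>n. (P g s (n + m) (- 1) :: int fps) $ (M - n)"
  have nth: "(of_nat (K g s n m) * fps_X ^ n * P g s (n + m) (- 1) :: int fps) $ M =
      (if n \<le> M then int (K g s n m) * ?p n else 0)" for n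
    by (simp add: fps_of_nat[symmetric] mult.assoc fps_X_power_mult_nth not_le)
  have fiber: "(\<Sum>xs\<in>{xs \<in> ?C. sum_list xs = n}. ?p (sum_list xs)) = int (K g s n m) * ?p n"
    if "n \<le> M" for n
  proof -
    have "{xs \<in> ?C. sum_list xs = n} =
        {xs \<in> gap_compositions g s. sum_list xs = n \<and> step_composition m xs}"
      using that by (auto simp: step_gap_compositions_def)
    moreover have "(\<Sum>xs\<in>{xs \<in> ?C. sum_list xs = n}. ?p (sum_list xs)) =
        (\<Sum>xs\<in>{xs \<in> ?C. sum_list xs = n}. ?p n)"
      by (rule sum.cong) auto
    ultimately show ?thesis
      by (simp only: K_def sum_constant)
  qed
  have "(\<Sum>n<N. (of_nat (K g s n m) * fps_X ^ n * P g s (n + m) (- 1) :: int fps) $ M) =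
      (\<Sum>n\<le>M. int (K g s n m) * ?p n)"
    unfolding nth using assms by (intro sum.mono_neutral_cong_right) auto
  also have "\<dots> = (\<Sum>n\<le>M. \<Sum>xs\<in>{xs \<in> ?C. sum_list xs = n}. ?p (sum_list xs))"
    by (intro sum.cong refl) (simp only: atMost_iff fiber)
  also have "\<dots> = (\<Sum>xs\<in>?C. ?p (sum_list xs))"
    using finite_step_gap_compositions by (intro sum.group) auto
  also have "\<dots> = (\<Sum>(xs, ys)\<in>cut_pairs g s m M. (- 1) ^ length ys)"
    unfolding cut_pairs_def P_def
    by (simp add: sum.Sigma finite_step_gap_compositions finite_gap_partitions)
  finally show ?thesis .
qed

theorem theorem3p1:
  fixes g s m :: nat
  assumes "s > 0" and "m > 0"
  shows "(\<lambda>n. of_nat (K g s n m) * fps_X ^ n * P g s (n + m) (- 1)) sums (1 :: int fps)"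
  by (rule fps_sums_eventually_nth) (simp add: nth_partial_sum sum_signed_pairs)

end
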